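(* Let $f(1)=1$ and, for $\alpha\ge 2$, let $f(\alpha)=\alpha+\alpha f(\alpha-1)$. If $D$ is a clique-acyclic digraph, then $\gamma(D)\le f(\alpha(D))$.
   Context: Digraphs are finite, loopless and have at least one vertex; $E(D)$ is the set of directed edges. A digraph $D$ is clique-acyclic if it has no directed (cyclic) triangle, i.e. no three vertices $u,v,w$ with $(u,v),(v,w),(w,u)\in E(D)$. $\alpha(D)$ is the maximum size of an independent set of $D$, i.e. of a set of vertices with no edge (in either direction) between any two of them. $\gamma(D)$ is the domination number of $D$: the smallest size of a set $U\subseteq V(D)$ such that every vertex $v\in V(D)\setminus U$ has some $u\in U$ with $(u,v)\in E(D)$. *)

theory Defs
  imports "Graph_Theory.Digraph"
begin

text \<open>
  Antiparallel arcs are permitted by the locale \<^locale>\<open>digraph\<close>, which excludes only loops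
  and parallel arcs.
\<close>

definition clique_acyclic :: "('a, 'b) pre_digraph \<Rightarrow> bool" where
  "clique_acyclic D \<longleftrightarrow>
    \<not> (\<exists>u\<in>verts D. \<exists>v\<in>verts D. \<exists>w\<in>verts D. u \<rightarrow>\<^bsub>D\<^esub> v \<and> v \<rightarrow>\<^bsub>D\<^esub> w \<and> w \<rightarrow>\<^bsub>D\<^esub> u)"

definition independent_set :: "('a, 'b) pre_digraph \<Rightarrow> 'a set \<Rightarrow> bool" where
  "independent_set D S \<longleftrightarrow>
    S \<subseteq> verts D \<and> (\<forall>u\<in>S. \<forall>v\<in>S. \<not> u \<rightarrow>\<^bsub>D\<^esub> v \<and> \<not> v \<rightarrow>\<^bsub>D\<^esub> u)"

definition independence_number :: "('a, 'b) pre_digraph \<Rightarrow> nat" where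
  "independence_number D = Max (card ` {S. independent_set D S})"

definition dominating_set :: "('a, 'b) pre_digraph \<Rightarrow> 'a set \<Rightarrow> bool" where
  "dominating_set D U \<longleftrightarrow> U \<subseteq> verts D \<and> (\<forall>v\<in>verts D - U. \<exists>u\<in>U. u \<rightarrow>\<^bsub>D\<^esub> v)"

definition domination_number :: "('a, 'b) pre_digraph \<Rightarrow> nat" where
  "domination_number D = Min (card ` {U. dominating_set D U})"

end

theory Submission
  imports Defs
begin

text \<open>
  The proof rests on the Chvatal--Lovasz theorem: every finite loopless digraph has a quasi-kernel,
  an independent set \<open>Q\<close> from which every vertex can be reached in at most two steps
  (\<open>quasi_kernel_exists\<close>). In the absence of directed triangles, a path \<open>q \<rightarrow> x \<rightarrow> v\<close> rules out the
  arc \<open>v \<rightarrow> q\<close>. Hence a vertex \<open>v\<close> that \<open>Q\<close> fails to dominate has a \<open>q \<in> Q\<close> to which it is not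
  adjacent in either direction (\<open>undominated_by_quasi_kernel\<close>).

  So the vertices that \<open>Q\<close> leaves undominated are covered by the sets of non-neighbours of the
  elements of \<open>Q\<close>. Adding \<open>q\<close> to an independent set of its non-neighbours keeps it independent, so
  each of these at most \<open>\<alpha>\<close> sets has independence number at most \<open>\<alpha> - 1\<close> and can, by induction, be
  dominated by at most \<open>f (\<alpha> - 1)\<close> of its own vertices. Together with \<open>Q\<close> itself this makes at most
  \<open>\<alpha> + \<alpha> f (\<alpha> - 1)\<close> vertices (\<open>small_dominating_set\<close>). For \<open>\<alpha> = 1\<close> a vertex has no
  non-neighbours, and the single vertex of \<open>Q\<close> already dominates everything.

  The induction passes to induced subdigraphs, which are represented by a vertex set \<open>W\<close> together
  with the adjacency relation \<open>E\<close> of the ambient digraph.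
\<close>

definition independent_on :: "('a \<Rightarrow> 'a \<Rightarrow> bool) \<Rightarrow> 'a set \<Rightarrow> bool" where
  "independent_on E S \<longleftrightarrow> (\<forall>u\<in>S. \<forall>v\<in>S. \<not> E u v)"

definition non_neighbours :: "('a \<Rightarrow> 'a \<Rightarrow> bool) \<Rightarrow> 'a set \<Rightarrow> 'a \<Rightarrow> 'a set" where
  "non_neighbours E W q = {v \<in> W. v \<noteq> q \<and> \<not> E q v \<and> \<not> E v q}"

definition quasi_kernel :: "('a \<Rightarrow> 'a \<Rightarrow> bool) \<Rightarrow> 'a set \<Rightarrow> 'a set \<Rightarrow> bool" where
  "quasi_kernel E W Q \<longleftrightarrow> Q \<subseteq> W \<and> independent_on E Q \<and>
    (\<forall>v\<in>W - Q. \<exists>q\<in>Q. E q v \<or> (\<exists>x\<in>W. E q x \<and> E x v))"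

text \<open>
  Remove a vertex \<open>v\<close> and its out-neighbours, and take a quasi-kernel \<open>Q\<close> of the rest. If \<open>Q\<close>
  dominates \<open>v\<close>, then it reaches the removed out-neighbours through \<open>v\<close>. Otherwise there is no arc
  between \<open>v\<close> and \<open>Q\<close> in either direction, and \<open>v\<close> can be added to \<open>Q\<close>.
\<close>
lemma quasi_kernel_exists:
  assumes "finite W" and irrefl: "\<And>v. v \<in> W \<Longrightarrow> \<not> E v v"
  shows "\<exists>Q. quasi_kernel E W Q"
  using assms
proof (induction W rule: finite_psubset_induct)
  case (psubset W)
  show ?case
  proof (cases "W = {}")
    case True
    then have "quasi_kernel E W {}"
      by (simp add: quasi_kernel_def independent_on_def)
    then show ?thesis ..
  next
    case False
    then obtain v where v: "v \<in> W" by blast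
    define W' where "W' = {w \<in> W. w \<noteq> v \<and> \<not> E v w}"
    have "W' \<subset> W" using v by (auto simp: W'_def)
    then obtain Q where Q: "quasi_kernel E W' Q"
      using psubset.IH[of W'] psubset.prems by blast
    show ?thesis
    proof (cases "\<exists>q\<in>Q. E q v")
      case True
      have "quasi_kernel E W Q"
        unfolding quasi_kernel_def
      proof (intro conjI ballI)
        show "Q \<subseteq> W" "independent_on E Q"
          using Q by (auto simp: quasi_kernel_def W'_def)
        fix w assume w: "w \<in> W - Q"
        show "\<exists>q\<in>Q. E q w \<or> (\<exists>x\<in>W. E q x \<and> E x w)"
        proof (cases "w \<in> W'")
          case True
          then show ?thesis
            using Q w \<open>W' \<subset> W\<close> unfolding quasi_kernel_def by blast
        next
          case False
          then have "w = v \<or> E v w" using w by (auto simp: W'_def)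
          then show ?thesis using \<open>\<exists>q\<in>Q. E q v\<close> v by blast
        qed
      qed
      then show ?thesis ..
    next
      case False
      have "quasi_kernel E W (insert v Q)"
        unfolding quasi_kernel_def
      proof (intro conjI ballI)
        show "insert v Q \<subseteq> W"
          using Q v by (auto simp: quasi_kernel_def W'_def)
        show "independent_on E (insert v Q)"
          using Q False psubset.prems[OF v]
          by (auto simp: quasi_kernel_def independent_on_def W'_def)
        fix w assume w: "w \<in> W - insert v Q"
        show "\<exists>q\<in>insert v Q. E q w \<or> (\<exists>x\<in>W. E q x \<and> E x w)"
        proof (cases "w \<in> W'")
          case True
          then show ?thesis
            using Q w \<open>W' \<subset> W\<close> unfolding quasi_kernel_def by blast
        next
          case False
          then show ?thesis using w by (auto simp: W'_def)
        qed
      qed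
      then show ?thesis ..
    qed
  qed
qed

text \<open>
  If \<open>v\<close> is reached by a path \<open>q \<rightarrow> x \<rightarrow> v\<close>, then an arc \<open>v \<rightarrow> q\<close> would close a directed triangle.
\<close>
lemma undominated_by_quasi_kernel:
  assumes "quasi_kernel E W Q"
    and no_triangle: "\<And>u v w. \<lbrakk>u \<in> W; v \<in> W; w \<in> W; E u v; E v w\<rbrakk> \<Longrightarrow> \<not> E w u"
    and v: "v \<in> W - Q" "\<not> (\<exists>q\<in>Q. E q v)"
  shows "\<exists>q\<in>Q. v \<in> non_neighbours E W q"
proof -
  obtain q x where "q \<in> Q" "x \<in> W" "E q x" "E x v" "Q \<subseteq> W"
    using assms(1) v unfolding quasi_kernel_def by blast
  then have "\<not> E v q"
    using no_triangle[of q x v] v by blast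
  then show ?thesis
    using \<open>q \<in> Q\<close> v by (auto simp: non_neighbours_def)
qed

lemma independent_on_insert_non_neighbours:
  assumes "\<not> E q q" "independent_on E S" "S \<subseteq> non_neighbours E W q"
  shows "independent_on E (insert q S)"
  using assms by (auto simp: independent_on_def non_neighbours_def)

text \<open>
  In the induction \<open>k\<close> is only an upper bound on the independence number, because the set of
  non-neighbours of a vertex may have independence number smaller than \<open>k - 1\<close>, or even be empty.
\<close>
lemma small_dominating_set:
  fixes f :: "nat \<Rightarrow> nat"
  assumes f1: "f 1 = 1"
    and f_rec: "\<And>k. k \<ge> 2 \<Longrightarrow> f k = k + k * f (k - 1)"
    and "k \<ge> 1"
    and "finite W"
    and "\<And>v. v \<in> W \<Longrightarrow> \<not> E v v"
    and "\<And>u v w. \<lbrakk>u \<in> W; v \<in> W; w \<in> W; E u v; E v w\<rbrakk> \<Longrightarrow> \<not> E w u"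
    and "\<And>S. \<lbrakk>S \<subseteq> W; independent_on E S\<rbrakk> \<Longrightarrow> card S \<le> k"
  shows "\<exists>U\<subseteq>W. card U \<le> f k \<and> (\<forall>v\<in>W - U. \<exists>u\<in>U. E u v)"
  using assms(3-)
proof (induction k arbitrary: W rule: dec_induct)
  case base
  then obtain Q where Q: "quasi_kernel E W Q"
    using quasi_kernel_exists by metis
  then have QW: "Q \<subseteq> W" "independent_on E Q" by (auto simp: quasi_kernel_def)
  have "\<exists>q\<in>Q. E q v" if v: "v \<in> W - Q" for v
  proof (rule ccontr)
    assume "\<not> (\<exists>q\<in>Q. E q v)"
    then obtain q where q: "q \<in> Q" "v \<in> non_neighbours E W q"
      using undominated_by_quasi_kernel[OF Q _ v] base.prems(3) by blast
    \<comment> \<open>A vertex and a non-neighbour of it would be an independent pair.\<close>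
    then have "independent_on E {q, v}"
      using QW v base.prems(2) by (auto simp: independent_on_def non_neighbours_def)
    then have "card {q, v} \<le> 1"
      using base.prems(4)[of "{q, v}"] q v QW by auto
    moreover have "q \<noteq> v" using q v by blast
    ultimately show False by simp
  qed
  moreover have "card Q \<le> f 1"
    using base.prems(4) QW f1 by simp
  ultimately show ?case using QW by blast
next
  case (step k)
  obtain Q where Q: "quasi_kernel E W Q"
    using quasi_kernel_exists step.prems(1,2) by metis
  then have QW: "Q \<subseteq> W" "independent_on E Q" by (auto simp: quasi_kernel_def)
  have finQ: "finite Q"
    using QW(1) step.prems(1) by (rule finite_subset)
  have cardQ: "card Q \<le> Suc k"
    using QW by (rule step.prems(4))
  have "\<exists>U\<subseteq>non_neighbours E W q. card U \<le> f k \<and>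
      (\<forall>v\<in>non_neighbours E W q - U. \<exists>u\<in>U. E u v)" if q: "q \<in> Q" for q
  proof (rule step.IH)
    have sub: "non_neighbours E W q \<subseteq> W" by (auto simp: non_neighbours_def)
    then show "finite (non_neighbours E W q)"
      using step.prems(1) finite_subset by blast
    show "\<not> E v v" if "v \<in> non_neighbours E W q" for v
      using that sub step.prems(2) by blast
    show "\<not> E w u" if "u \<in> non_neighbours E W q" "v \<in> non_neighbours E W q"
      "w \<in> non_neighbours E W q" "E u v" "E v w" for u v w
      using that sub step.prems(3) by blast
    show "card S \<le> k" if S: "S \<subseteq> non_neighbours E W q" "independent_on E S" for S
    proof -
      have "q \<in> W" using q QW(1) by blast
      then have "independent_on E (insert q S)"
        by (rule independent_on_insert_non_neighbours[OF step.prems(2) S(2,1)])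
      moreover have "insert q S \<subseteq> W"
        using \<open>q \<in> W\<close> S(1) sub by blast
      ultimately have "card (insert q S) \<le> Suc k"
        using step.prems(4) by blast
      moreover have "q \<notin> S"
        using S by (auto simp: non_neighbours_def)
      moreover have "finite S"
        using S(1) sub step.prems(1) by (meson finite_subset)
      ultimately show ?thesis by simp
    qed
  qed
  then obtain U where U: "\<And>q. q \<in> Q \<Longrightarrow> U q \<subseteq> non_neighbours E W q"
      "\<And>q. q \<in> Q \<Longrightarrow> card (U q) \<le> f k"
      "\<And>q v. \<lbrakk>q \<in> Q; v \<in> non_neighbours E W q - U q\<rbrakk> \<Longrightarrow> \<exists>u\<in>U q. E u v"
    by metis
  define T where "T = Q \<union> (\<Union>q\<in>Q. U q)"
  have "T \<subseteq> W"
    using QW U(1) by (fastforce simp: T_def non_neighbours_def)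
  moreover have "card T \<le> f (Suc k)"
  proof -
    have "card (\<Union>q\<in>Q. U q) \<le> (\<Sum>q\<in>Q. card (U q))"
      using finQ by (rule card_UN_le)
    also have "\<dots> \<le> card Q * f k"
      using sum_bounded_above[of Q "\<lambda>q. card (U q)" "f k"] U(2) by simp
    also have "\<dots> \<le> Suc k * f k"
      using cardQ by (rule mult_le_mono1)
    finally have "card T \<le> Suc k + Suc k * f k"
      unfolding T_def using cardQ card_Un_le[of Q "\<Union>q\<in>Q. U q"] by linarith
    then show ?thesis using f_rec[of "Suc k"] step.hyps by simp
  qed
  moreover have "\<exists>u\<in>T. E u v" if v: "v \<in> W - T" for v
  proof (cases "\<exists>q\<in>Q. E q v")
    case True
    then show ?thesis by (auto simp: T_def)
  next
    case False
    have "v \<in> W - Q" using v by (auto simp: T_def)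
    then obtain q where "q \<in> Q" "v \<in> non_neighbours E W q"
      using undominated_by_quasi_kernel[OF Q _ _ False] step.prems(3) by blast
    then show ?thesis using U(3)[of q v] v by (auto simp: T_def)
  qed
  ultimately show ?case by blast
qed

theorem theorem3:
  fixes D :: "('a, 'b) pre_digraph" and f :: "nat \<Rightarrow> nat"
  assumes "f 1 = 1"
    and "\<And>\<alpha>. \<alpha> \<ge> 2 \<Longrightarrow> f \<alpha> = \<alpha> + \<alpha> * f (\<alpha> - 1)"
    and "digraph D"
    and "verts D \<noteq> {}"
    and "clique_acyclic D"
  shows "domination_number D \<le> f (independence_number D)"
proof -
  interpret digraph D by fact
  define E where "E = (\<lambda>u v. u \<rightarrow>\<^bsub>D\<^esub> v)"
  have irrefl: "\<not> E v v" for v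
    using adj_not_same by (auto simp: E_def)
  have indep_iff: "independent_set D S \<longleftrightarrow> S \<subseteq> verts D \<and> independent_on E S" for S
    by (auto simp: independent_set_def independent_on_def E_def)
  have fin_indep: "finite {S. independent_set D S}"
    by (rule finite_subset[of _ "Pow (verts D)"]) (auto simp: independent_set_def)
  have card_le: "card S \<le> independence_number D" if "S \<subseteq> verts D" "independent_on E S" for S
    using that fin_indep by (auto simp: independence_number_def indep_iff intro!: Max_ge)
  obtain v where "v \<in> verts D" using assms(4) by blast
  then have "independence_number D \<ge> 1"
    using card_le[of "{v}"] irrefl by (auto simp: independent_on_def)
  moreover have "\<not> E w u"
    if "u \<in> verts D" "v \<in> verts D" "w \<in> verts D" "E u v" "E v w" for u v w
    using that assms(5) unfolding clique_acyclic_def E_def by blast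
  ultimately obtain U where U: "U \<subseteq> verts D" "card U \<le> f (independence_number D)"
      "\<forall>v\<in>verts D - U. \<exists>u\<in>U. E u v"
    using small_dominating_set[of f "independence_number D" "verts D" E,
      OF assms(1,2) _ finite_verts irrefl _ card_le] by blast
  then have "dominating_set D U"
    by (simp add: dominating_set_def E_def)
  moreover have "finite {U. dominating_set D U}"
    by (rule finite_subset[of _ "Pow (verts D)"]) (auto simp: dominating_set_def)
  ultimately have "domination_number D \<le> card U"
    by (auto simp: domination_number_def intro!: Min_le)
  then show ?thesis using U(2) by linarith
qed

end
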